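(* Let $G$ be a finite graph having $P_{2,2}$ as a full subgraph; that is, $G$ has four distinct vertices $u_1,u_2,v_1,v_2$ such that the full subgraph of $G$ on them has exactly the edges $u_1u_2$, $v_1v_2$, $u_1v_1$, $u_2v_2$. Let $H$ be the graph obtained from $G$ by replacing this $P_{2,2}$ with $P_{2,4}$ as follows: remove the edges $u_1v_1$ and $u_2v_2$, add four new vertices $x_1,x_2,y_1,y_2$, and add the edges $$u_1x_1,\ x_1y_1,\ y_1v_2,\quad u_2x_2,\ x_2y_2,\ y_2v_1,\quad x_1x_2,\ y_1y_2$$ (all other vertices and edges of $G$, including $u_1u_2$ and $v_1v_2$, are unchanged). Then $I(H)$ and $\Sigma I(G)$ have the same simple homotopy type.
   Context: Graphs are finite and undirected; loops and multiple edges are allowed. A full subgraph is an induced subgraph. The planar square grid graph $P_{m,n}$ has vertex set $\{1,\dots,m\}\times\{1,\dots,n\}$, with $(i_1,j_1)$ and $(i_2,j_2)$ adjacent if and only if they differ by exactly $1$ in one coordinate and agree in the other. In $H$, the full subgraph on $u_1,u_2,x_1,x_2,y_1,y_2,v_1,v_2$ is a copy of $P_{2,4}$ with rows $u_1,x_1,y_1,v_2$ and $u_2,x_2,y_2,v_1$. An independent set of a graph is a set of vertices no two of which are joined by an edge (a vertex carrying a loop belongs to no independent set). The independence complex $I(G)$ is the simplicial complex whose simplices are the independent sets of $G$ (including the empty set $\emptyset$). For a simplicial complex $K$, $\Sigma K$ denotes the simplicial suspension of $K$, i.e. the join of $K$ with $\partial\Delta^1$ (two points). An elementary collapse of a simplicial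 complex removes a pair of simplices $\sigma\subsetneq\tau$, with $\sigma$ nonempty, $\dim\tau=\dim\sigma+1$, and $\tau$ the only simplex properly containing $\sigma$; an elementary expansion is the inverse operation. Two finite simplicial complexes have the same simple homotopy type if they are connected, up to simplicial isomorphism, by a finite sequence of elementary collapses and elementary expansions. *)

theory Defs
  imports "HOL-Library.Multiset" "HOL-Library.Uprod"
begin

section \<open>Finite undirected graphs with loops and multiple edges\<close>

text \<open>
  An edge is an unordered pair of vertices; \<^term>\<open>Upair v v\<close> is a loop at \<open>v\<close>, and the
  multiplicity in the multiset is the number of parallel edges.
\<close>

record 'a multigraph =
  verts :: "'a set"
  edges :: "'a uprod multiset"

definition finite_graph :: "'a multigraph \<Rightarrow> bool" where
  "finite_graph G \<longleftrightarrow> finite (verts G) \<and> (\<forall>e \<in># edges G. set_uprod e \<subseteq> verts G)"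

definition full_subgraph :: "'a multigraph \<Rightarrow> 'a set \<Rightarrow> 'a multigraph" where
  "full_subgraph G W = \<lparr>verts = W, edges = {#e \<in># edges G. set_uprod e \<subseteq> W#}\<rparr>"

definition replace_square ::
  "'a multigraph \<Rightarrow> 'a \<Rightarrow> 'a \<Rightarrow> 'a \<Rightarrow> 'a \<Rightarrow> 'a \<Rightarrow> 'a \<Rightarrow> 'a \<Rightarrow> 'a \<Rightarrow> 'a multigraph" where
  "replace_square G u\<^sub>1 u\<^sub>2 v\<^sub>1 v\<^sub>2 x\<^sub>1 x\<^sub>2 y\<^sub>1 y\<^sub>2 =
     \<lparr>verts = verts G \<union> {x\<^sub>1, x\<^sub>2, y\<^sub>1, y\<^sub>2},
      edges = (edges G - {#Upair u\<^sub>1 v\<^sub>1, Upair u\<^sub>2 v\<^sub>2#})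
        + {#Upair u\<^sub>1 x\<^sub>1, Upair x\<^sub>1 y\<^sub>1, Upair y\<^sub>1 v\<^sub>2,
            Upair u\<^sub>2 x\<^sub>2, Upair x\<^sub>2 y\<^sub>2, Upair y\<^sub>2 v\<^sub>1,
            Upair x\<^sub>1 x\<^sub>2, Upair y\<^sub>1 y\<^sub>2#}\<rparr>"

text \<open>The case \<open>u = v\<close> excludes vertices carrying a loop.\<close>

definition independent_set :: "'a multigraph \<Rightarrow> 'a set \<Rightarrow> bool" where
  "independent_set G S \<longleftrightarrow> S \<subseteq> verts G \<and> (\<forall>u\<in>S. \<forall>v\<in>S. Upair u v \<notin># edges G)"

section \<open>Finite simplicial complexes\<close>

text \<open>
  A complex is the set of its simplices, including the empty one; its vertex set is
  \<^term>\<open>\<Union>K\<close>.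
\<close>

definition finite_simplicial_complex :: "'a set set \<Rightarrow> bool" where
  "finite_simplicial_complex K \<longleftrightarrow>
     finite K \<and> (\<forall>\<sigma>\<in>K. finite \<sigma>) \<and> {} \<in> K \<and> (\<forall>\<sigma>\<in>K. \<forall>\<rho>. \<rho> \<subseteq> \<sigma> \<longrightarrow> \<rho> \<in> K)"

definition independence_complex :: "'a multigraph \<Rightarrow> 'a set set" where
  "independence_complex G = {S. independent_set G S}"

definition simplicial_join :: "'a set set \<Rightarrow> 'b set set \<Rightarrow> ('a + 'b) set set" where
  "simplicial_join K L = {\<sigma> <+> \<tau> | \<sigma> \<tau>. \<sigma> \<in> K \<and> \<tau> \<in> L}"

text \<open>The boundary of the 1-simplex on the vertex set \<^typ>\<open>bool\<close>: two points.\<close>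

definition boundary_simplex1 :: "bool set set" where
  "boundary_simplex1 = {\<sigma>. \<sigma> \<subset> {False, True}}"

definition suspension :: "'a set set \<Rightarrow> ('a + bool) set set" where
  "suspension K = simplicial_join K boundary_simplex1"

definition simplicial_isomorphic :: "'a set set \<Rightarrow> 'b set set \<Rightarrow> bool" where
  "simplicial_isomorphic K L \<longleftrightarrow>
     (\<exists>f. bij_betw f (\<Union>K) (\<Union>L) \<and> (\<forall>\<sigma>. \<sigma> \<subseteq> \<Union>K \<longrightarrow> (\<sigma> \<in> K \<longleftrightarrow> f ` \<sigma> \<in> L)))"

section \<open>Simple homotopy type\<close>

text \<open>\<^term>\<open>card \<tau> = card \<sigma> + 1\<close> is the condition that the dimensions differ by one.\<close>

definition elementary_collapse :: "'a set set \<Rightarrow> 'a set set \<Rightarrow> bool" where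
  "elementary_collapse K L \<longleftrightarrow> finite_simplicial_complex K \<and>
     (\<exists>\<sigma>\<in>K. \<exists>\<tau>\<in>K. \<sigma> \<noteq> {} \<and> \<sigma> \<subset> \<tau> \<and> card \<tau> = card \<sigma> + 1 \<and>
        (\<forall>\<rho>\<in>K. \<sigma> \<subset> \<rho> \<longrightarrow> \<rho> = \<tau>) \<and> L = K - {\<sigma>, \<tau>})"

definition elementary_expansion :: "'a set set \<Rightarrow> 'a set set \<Rightarrow> bool" where
  "elementary_expansion K L \<longleftrightarrow> elementary_collapse L K"

definition simple_homotopy_step :: "'a set set \<Rightarrow> 'a set set \<Rightarrow> bool" where
  "simple_homotopy_step K L \<longleftrightarrow>
     elementary_collapse K L \<or> elementary_expansion K L \<or> simplicial_isomorphic K L"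

text \<open>
  The intermediate complexes live on vertices in \<^typ>\<open>nat\<close>: expansions may need fresh
  vertices, which the vertex types of \<open>K\<close> and \<open>L\<close> need not provide, and every finite
  complex is isomorphic to one with vertices in \<^typ>\<open>nat\<close>.
\<close>

definition same_simple_homotopy_type :: "'a set set \<Rightarrow> 'b set set \<Rightarrow> bool" where
  "same_simple_homotopy_type K L \<longleftrightarrow>
     finite_simplicial_complex K \<and> finite_simplicial_complex L \<and>
     (\<exists>K' L' :: nat set set.
        simplicial_isomorphic K K' \<and> simple_homotopy_step\<^sup>*\<^sup>* K' L' \<and> simplicial_isomorphic L' L)"

end

(*
  Both complexes are compared with the independence complex of H with u1v1, u2v2 restored and
  y2v1, y1v2 deleted, through steps of one kind: if every neighbour of a vertex c is adjacent to a
  member of P, then adding c to and removing c from an independent set containing P pairs off all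
  such sets, and removing the pairs in order of decreasing size is a sequence of elementary
  collapses. Restoring u1v1 (c = x2), u2v2 (c = x1), y2v1 (c = x1) or y1v2 (c = x2) is such a
  step. In the intermediate graph, x1 and x2 are dominated by y2 and y1 and can be deleted, which
  leaves G together with one disjoint edge y1y2.
*)
theory Submission
  imports Defs
begin

section \<open>Collapses\<close>

lemma finite_simplicial_complex_down:
  assumes "finite_simplicial_complex K" "\<sigma> \<in> K" "\<rho> \<subseteq> \<sigma>"
  shows "\<rho> \<in> K"
  using assms unfolding finite_simplicial_complex_def by simp

text \<open>Down-closure survives because a proper coface of \<sigma> can only be \<tau>, and a
  proper coface of \<tau> would be another proper coface of \<sigma>. The empty simplex survives
  because \<sigma> is nonempty.\<close>

lemma finite_simplicial_complex_elementary_collapse: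
  assumes "elementary_collapse K L"
  shows "finite_simplicial_complex L"
proof -
  obtain \<sigma> \<tau> where K: "finite_simplicial_complex K"
    and st: "\<sigma> \<noteq> {}" "\<sigma> \<subset> \<tau>" and free: "\<forall>\<rho>\<in>K. \<sigma> \<subset> \<rho> \<longrightarrow> \<rho> = \<tau>" and L: "L = K - {\<sigma>, \<tau>}"
    using assms unfolding elementary_collapse_def by blast
  have "\<rho> \<in> L" if "\<pi> \<in> L" "\<rho> \<subseteq> \<pi>" for \<pi> \<rho>
  proof -
    have "\<pi> \<in> K" "\<pi> \<noteq> \<sigma>" "\<pi> \<noteq> \<tau>"
      using that(1) L by auto
    moreover have "\<rho> \<in> K"
      using finite_simplicial_complex_down[OF K \<open>\<pi> \<in> K\<close> that(2)] .
    ultimately show ?thesis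
      using that(2) L free st(2) by blast
  qed
  moreover have "finite L" "\<forall>\<sigma>\<in>L. finite \<sigma>" "{} \<in> L"
    using K st(1,2) L unfolding finite_simplicial_complex_def by auto
  ultimately show ?thesis
    unfolding finite_simplicial_complex_def by simp
qed

text \<open>Toggling \<open>c\<close> matches the simplices of \<open>K - L\<close> in pairs. A pair
  whose member without \<open>c\<close> is maximal can be collapsed, and induction on
  \<open>card (K - L)\<close> removes the rest. As \<open>L\<close> is a complex, it contains the
  empty simplex, so only nonempty simplices are removed.\<close>

lemma toggle_collapses:
  assumes "finite_simplicial_complex K" "finite_simplicial_complex L" "L \<subseteq> K"
    and "\<And>\<sigma>. \<sigma> \<in> K - L \<Longrightarrow> insert c \<sigma> \<in> K - L"
    and "\<And>\<sigma>. \<sigma> \<in> K - L \<Longrightarrow> \<sigma> - {c} \<in> K - L"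
  shows "elementary_collapse\<^sup>*\<^sup>* K L"
  using assms
proof (induction "card (K - L)" arbitrary: K rule: less_induct)
  case less
  show ?case
  proof (cases "K = L")
    case False
    have fin: "finite K" "\<And>\<sigma>. \<sigma> \<in> K \<Longrightarrow> finite \<sigma>"
      using less.prems(1) unfolding finite_simplicial_complex_def by auto
    define A where "A = {\<sigma> \<in> K - L. c \<notin> \<sigma>}"
    obtain \<pi> where "\<pi> \<in> K - L"
      using False less.prems(3) by blast
    then have "A \<noteq> {}"
      using less.prems(5)[of \<pi>] unfolding A_def by blast
    moreover have "finite A"
      unfolding A_def using fin by simp
    ultimately obtain \<sigma> where \<sigma>: "\<sigma> \<in> A" and max: "\<And>\<rho>. \<rho> \<in> A \<Longrightarrow> \<sigma> \<subseteq> \<rho> \<Longrightarrow> \<rho> = \<sigma>"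
      using finite_has_maximal[of A] by auto
    have sK: "\<sigma> \<in> K" "\<sigma> \<notin> L" "c \<notin> \<sigma>"
      using \<sigma> unfolding A_def by auto
    define \<tau> where "\<tau> = insert c \<sigma>"
    have tK: "\<tau> \<in> K" "\<tau> \<notin> L"
      using less.prems(4)[of \<sigma>] sK unfolding \<tau>_def by auto
    have L_down: "\<rho> \<in> L" if "\<pi> \<in> L" "\<rho> \<subseteq> \<pi>" for \<pi> \<rho>
      using finite_simplicial_complex_down[OF less.prems(2) that] .
    have "{} \<in> L"
      using less.prems(2) unfolding finite_simplicial_complex_def by simp
    then have "\<sigma> \<noteq> {}"
      using sK(2) by blast
    \<comment> \<open>A coface of \<sigma> cannot lie in \<open>L\<close>, since then \<sigma> would
      too. Stripping \<open>c\<close> from it gives a member of \<open>A\<close> above \<sigma>, so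
      maximality leaves only \<tau>.\<close>
    have free: "\<rho> = \<tau>" if "\<rho> \<in> K" "\<sigma> \<subset> \<rho>" for \<rho>
    proof -
      have "\<rho> \<notin> L"
        using L_down[of \<rho> \<sigma>] that(2) sK(2) by blast
      then have "\<rho> - {c} \<in> A"
        using less.prems(5)[of \<rho>] that(1) unfolding A_def by simp
      moreover have "\<sigma> \<subseteq> \<rho> - {c}"
        using that(2) sK(3) by blast
      ultimately have "\<rho> - {c} = \<sigma>"
        by (rule max)
      then show ?thesis
        using that unfolding \<tau>_def by blast
    qed
    define K' where "K' = K - {\<sigma>, \<tau>}"
    have step: "elementary_collapse K K'"
      unfolding elementary_collapse_def
    proof (rule conjI, fact less.prems(1), rule bexI[of _ \<sigma>], rule bexI[of _ \<tau>], intro conjI ballI impI)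
      show "card \<tau> = card \<sigma> + 1"
        using fin(2)[OF sK(1)] sK(3) unfolding \<tau>_def by simp
      show "\<sigma> \<subset> \<tau>"
        using sK(3) unfolding \<tau>_def by blast
    qed (fact sK tK \<open>\<sigma> \<noteq> {}\<close> free K'_def)+
    have eq: "K' - L = K - L - {\<sigma>, \<tau>}"
      unfolding K'_def by blast
    have "elementary_collapse\<^sup>*\<^sup>* K' L"
    proof (rule less.hyps)
      show "card (K' - L) < card (K - L)"
        using sK fin(1) unfolding eq by (intro psubset_card_mono) blast+
      show "finite_simplicial_complex K'"
        using step by (rule finite_simplicial_complex_elementary_collapse)
      show "L \<subseteq> K'"
        unfolding K'_def using less.prems(3) sK tK by blast
      \<comment> \<open>The removed pair is a full orbit under toggling \<open>c\<close>, so no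
        simplex outside the pair is sent into it; the same holds for removing \<open>c\<close>
        below.\<close>
      show "insert c \<pi> \<in> K' - L" if "\<pi> \<in> K' - L" for \<pi>
      proof -
        have "insert c \<pi> \<noteq> \<sigma>"
          using sK by blast
        moreover have "\<pi> = \<sigma> \<or> \<pi> = \<tau>" if "insert c \<pi> = \<tau>"
          using that sK unfolding \<tau>_def by (metis insert_absorb insert_ident)
        then have "insert c \<pi> \<noteq> \<tau>"
          using that unfolding eq by blast
        ultimately show ?thesis
          using that less.prems(4)[of \<pi>] unfolding eq by blast
      qed
      show "\<pi> - {c} \<in> K' - L" if "\<pi> \<in> K' - L" for \<pi>
      proof -
        have "\<pi> - {c} \<noteq> \<tau>"
          unfolding \<tau>_def by blast
        moreover have "\<pi> = \<sigma> \<or> \<pi> = \<tau>" if "\<pi> - {c} = \<sigma>"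
          using that unfolding \<tau>_def by blast
        then have "\<pi> - {c} \<noteq> \<sigma>"
          using that unfolding eq by blast
        ultimately show ?thesis
          using that less.prems(5)[of \<pi>] unfolding eq by blast
      qed
    qed (use less.prems(2) in simp)
    with step show ?thesis
      by (rule converse_rtranclp_into_rtranclp)
  qed simp
qed

section \<open>Relabelling the vertices\<close>

lemma image_mem_image_complex_iff:
  assumes "inj_on f (\<Union>K)" "\<sigma> \<subseteq> \<Union>K"
  shows "f ` \<sigma> \<in> image f ` K \<longleftrightarrow> \<sigma> \<in> K"
proof
  assume "f ` \<sigma> \<in> image f ` K"
  then obtain \<rho> where "\<rho> \<in> K" "f ` \<sigma> = f ` \<rho>"
    by blast
  then show "\<sigma> \<in> K"
    using inj_on_image_eq_iff[OF assms, of \<rho>] by (simp add: Union_upper)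
qed blast

text \<open>The isomorphism is the transition map: undo \<open>g\<close>, then apply
  \<open>f\<close>. Taking \<open>g\<close> to be the identity compares \<open>K\<close> itself with
  a relabelled copy.\<close>

lemma simplicial_isomorphic_images:
  assumes f: "inj_on f (\<Union>K)" and g: "inj_on g (\<Union>K)"
  shows "simplicial_isomorphic (image g ` K) (image f ` K)"
proof -
  define h where "h = f \<circ> inv_into (\<Union>K) g"
  have U: "\<Union>(image g ` K) = g ` \<Union>K" "\<Union>(image f ` K) = f ` \<Union>K"
    by (simp_all only: image_Union)
  have hg: "h (g v) = f v" if "v \<in> \<Union>K" for v
    unfolding h_def comp_apply inv_into_f_f[OF g that] ..
  have h: "h ` g ` \<rho> = f ` \<rho>" if "\<rho> \<subseteq> \<Union>K" for \<rho>
    unfolding image_image by (rule image_cong[OF refl]) (rule hg, rule subsetD[OF that])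
  have "bij_betw h (g ` \<Union>K) (f ` \<Union>K)"
    unfolding h_def
    using bij_betw_trans[OF bij_betw_inv_into[OF inj_on_imp_bij_betw[OF g]] inj_on_imp_bij_betw[OF f]] .
  moreover have "\<sigma> \<in> image g ` K \<longleftrightarrow> h ` \<sigma> \<in> image f ` K" if sub: "\<sigma> \<subseteq> g ` \<Union>K" for \<sigma>
  proof -
    obtain \<rho> where \<rho>: "\<rho> \<subseteq> \<Union>K" "\<sigma> = g ` \<rho>"
      by (rule subset_imageE[OF sub])
    show ?thesis
      unfolding \<rho>(2) h[OF \<rho>(1)] image_mem_image_complex_iff[OF f \<rho>(1)]
        image_mem_image_complex_iff[OF g \<rho>(1)] ..
  qed
  ultimately show ?thesis
    unfolding simplicial_isomorphic_def U by (intro exI[of _ h] conjI allI impI)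
qed

lemma finite_simplicial_complex_image:
  assumes "finite_simplicial_complex K"
  shows "finite_simplicial_complex (image f ` K)"
  unfolding finite_simplicial_complex_def
proof (intro conjI ballI allI impI)
  fix \<sigma> \<rho> assume "\<sigma> \<in> image f ` K" "\<rho> \<subseteq> \<sigma>"
  then obtain \<pi> where \<pi>: "\<pi> \<in> K" "\<rho> \<subseteq> f ` \<pi>"
    by auto
  obtain \<pi>' where "\<pi>' \<subseteq> \<pi>" "\<rho> = f ` \<pi>'"
    by (rule subset_imageE[OF \<pi>(2)])
  then show "\<rho> \<in> image f ` K"
    using finite_simplicial_complex_down[OF assms \<pi>(1)] by simp
qed (use assms in \<open>auto simp: finite_simplicial_complex_def\<close>)

lemma elementary_collapse_image:
  assumes "elementary_collapse K L" and inj: "inj_on f (\<Union>K)"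
  shows "elementary_collapse (image f ` K) (image f ` L)"
proof -
  obtain \<sigma> \<tau> where K: "finite_simplicial_complex K" and mem: "\<sigma> \<in> K" "\<tau> \<in> K"
    and st: "\<sigma> \<noteq> {}" "\<sigma> \<subset> \<tau>" "card \<tau> = card \<sigma> + 1"
    and free: "\<forall>\<rho>\<in>K. \<sigma> \<subset> \<rho> \<longrightarrow> \<rho> = \<tau>" and L: "L = K - {\<sigma>, \<tau>}"
    using assms(1) unfolding elementary_collapse_def by blast
  have inj': "inj_on f \<rho>" if "\<rho> \<in> K" for \<rho>
    using inj_on_subset[OF inj Union_upper[OF that]] .
  \<comment> \<open>Injectivity on the vertices makes taking images an order embedding of simplices,
    so the free face stays free after relabelling.\<close>
  have le: "f ` \<rho> \<subseteq> f ` \<pi> \<longleftrightarrow> \<rho> \<subseteq> \<pi>" if mem: "\<rho> \<in> K" "\<pi> \<in> K" for \<rho> \<pi>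
  proof
    assume sub: "f ` \<rho> \<subseteq> f ` \<pi>"
    show "\<rho> \<subseteq> \<pi>"
    proof
      fix v assume "v \<in> \<rho>"
      with mem(1) have "v \<in> \<Union>K"
        by (rule UnionI)
      then show "v \<in> \<pi>"
        using inj_on_image_mem_iff[OF inj _ Union_upper[OF mem(2)], of v] sub \<open>v \<in> \<rho>\<close> by auto
    qed
  qed (rule image_mono)
  have eq: "f ` \<rho> = f ` \<pi> \<longleftrightarrow> \<rho> = \<pi>" if "\<rho> \<in> K" "\<pi> \<in> K" for \<rho> \<pi>
    using le that by (simp add: set_eq_subset)
  have less: "f ` \<rho> \<subset> f ` \<pi> \<longleftrightarrow> \<rho> \<subset> \<pi>" if "\<rho> \<in> K" "\<pi> \<in> K" for \<rho> \<pi>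
    using le that by (simp add: less_le_not_le)
  have L': "image f ` L = image f ` K - {f ` \<sigma>, f ` \<tau>}"
    using mem eq unfolding L by (auto simp del: image_eqI intro!: imageI)
  show ?thesis
    unfolding elementary_collapse_def
  proof (rule conjI, rule finite_simplicial_complex_image[OF K],
      rule bexI[of _ "f ` \<sigma>"], rule bexI[of _ "f ` \<tau>"], intro conjI ballI impI)
    show "card (f ` \<tau>) = card (f ` \<sigma>) + 1"
      using st(3) mem inj' by (simp add: card_image)
    show "f ` \<sigma> \<subset> f ` \<tau>"
      using less mem st(2) by simp
    fix \<rho> assume "\<rho> \<in> image f ` K" and sub: "f ` \<sigma> \<subset> \<rho>"
    then obtain \<pi> where \<pi>: "\<pi> \<in> K" "\<rho> = f ` \<pi>"
      by (elim imageE)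
    then have "\<sigma> \<subset> \<pi>"
      using less[OF mem(1)] sub by simp
    then show "\<rho> = f ` \<tau>"
      using free \<pi> by simp
  qed (use st(1) mem L' in simp_all)
qed

lemma collapses_image:
  assumes "elementary_collapse\<^sup>*\<^sup>* K L" "inj_on f (\<Union>K)"
  shows "elementary_collapse\<^sup>*\<^sup>* (image f ` K) (image f ` L)"
  using assms
proof (induction rule: converse_rtranclp_induct)
  case (step K M)
  have "M \<subseteq> K"
    using step.hyps(1) unfolding elementary_collapse_def by blast
  then have "inj_on f (\<Union>M)"
    using step.prems by (meson Union_mono inj_on_subset)
  then show ?case
    using elementary_collapse_image[OF step.hyps(1) step.prems] step.IH
    by (meson converse_rtranclp_into_rtranclp)
qed simp

section \<open>Chains and zigzags of collapses\<close>

lemma collapses_imp_steps: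
  assumes "elementary_collapse\<^sup>*\<^sup>* K L"
  shows "simple_homotopy_step\<^sup>*\<^sup>* K L" "simple_homotopy_step\<^sup>*\<^sup>* L K"
proof -
  show "simple_homotopy_step\<^sup>*\<^sup>* K L"
    using assms
    by (rule rtranclp_mono[THEN predicate2D, rotated]) (auto simp: simple_homotopy_step_def)
  have "elementary_expansion\<^sup>*\<^sup>* L K"
    using assms by (induction rule: rtranclp_induct)
      (auto simp: elementary_expansion_def intro: converse_rtranclp_into_rtranclp)
  then show "simple_homotopy_step\<^sup>*\<^sup>* L K"
    by (rule rtranclp_mono[THEN predicate2D, rotated]) (auto simp: simple_homotopy_step_def)
qed

text \<open>The shape of the main argument: collapse \<open>K\<close> to \<open>L\<close>, expand to
  \<open>M\<close>, collapse to \<open>N\<close>. The final relabelling \<open>f\<close> may change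
  the vertex type, as is needed for a suspension, whose vertices form a sum type.\<close>

lemma same_simple_homotopy_type_zigzag:
  fixes K L M N :: "'a set set" and f :: "'a \<Rightarrow> 'b"
  assumes K: "finite_simplicial_complex K" and M: "finite_simplicial_complex M"
    and to_L: "elementary_collapse\<^sup>*\<^sup>* K L" and expand_L: "elementary_collapse\<^sup>*\<^sup>* M L"
    and to_N: "elementary_collapse\<^sup>*\<^sup>* M N" and f: "inj_on f (\<Union>N)"
  shows "same_simple_homotopy_type K (image f ` N)"
proof -
  have fsc: "finite_simplicial_complex B"
    if "elementary_collapse\<^sup>*\<^sup>* A B" "finite_simplicial_complex A" for A B :: "'a set set"
    using that by (induction rule: rtranclp_induct)
      (auto intro: finite_simplicial_complex_elementary_collapse)
  have N: "finite_simplicial_complex N"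
    using fsc to_N M by blast
  have "finite (\<Union>K \<union> \<Union>M \<union> \<Union>N)"
    using K M N unfolding finite_simplicial_complex_def by auto
  \<comment> \<open>A single injection serves all complexes, so that both chains ending in
    \<open>L\<close> end in the same copy of it over \<open>nat\<close>.\<close>
  then obtain g :: "'a \<Rightarrow> nat" where g: "inj_on g (\<Union>K \<union> \<Union>M \<union> \<Union>N)"
    using finite_imp_inj_to_nat_seg by metis
  have gK: "inj_on g (\<Union>K)" and gM: "inj_on g (\<Union>M)" and gN: "inj_on g (\<Union>N)"
    using g by (auto intro: inj_on_subset)
  have "simple_homotopy_step\<^sup>*\<^sup>* (image g ` K) (image g ` N)"
    using collapses_imp_steps[OF collapses_image[OF to_L gK]]
      collapses_imp_steps[OF collapses_image[OF expand_L gM]]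
      collapses_imp_steps[OF collapses_image[OF to_N gM]]
    by (meson rtranclp_trans)
  moreover have "simplicial_isomorphic K (image g ` K)"
    using simplicial_isomorphic_images[OF gK, of id] by simp
  moreover have "simplicial_isomorphic (image g ` N) (image f ` N)"
    using simplicial_isomorphic_images[OF f gN] .
  ultimately show ?thesis
    unfolding same_simple_homotopy_type_def
    using K finite_simplicial_complex_image[OF N] by blast
qed

section \<open>Independent sets\<close>

text \<open>
  The independence complex depends only on the set of edges, so multiplicities are dropped here.
\<close>

definition indep :: "'a set \<Rightarrow> 'a uprod set \<Rightarrow> 'a set set" where
  "indep V E = {S. S \<subseteq> V \<and> (\<forall>u\<in>S. \<forall>v\<in>S. Upair u v \<notin> E)}"

lemma independence_complex_eq_indep:
  "independence_complex G = indep (verts G) (set_mset (edges G))"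
  unfolding independence_complex_def independent_set_def indep_def ..

lemma finite_simplicial_complex_indep:
  assumes "finite V"
  shows "finite_simplicial_complex (indep V E)"
proof -
  have "indep V E \<subseteq> Pow V"
    unfolding indep_def by blast
  then have "finite (indep V E)"
    using assms by (meson finite_Pow_iff finite_subset)
  then show ?thesis
    using assms unfolding finite_simplicial_complex_def indep_def
    by (auto intro: finite_subset)
qed

lemma Upair_commute: "Upair v w = Upair w v"
  by simp

text \<open>With the next identity, adding an edge and deleting a vertex become the same operation,
  namely discarding all simplices that contain a fixed set \<open>P\<close>, here a pair and there a
  singleton.\<close>

lemma indep_insert_edge: "indep V (insert (Upair p q) E) = {S \<in> indep V E. \<not> {p, q} \<subseteq> S}"
  unfolding indep_def by auto

lemma indep_delete_vertex: "indep (V - {p}) E = {S \<in> indep V E. \<not> {p} \<subseteq> S}"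
  unfolding indep_def by blast

text \<open>An independent set containing \<open>P\<close> contains no neighbour of
  \<open>c\<close>, as each is adjacent to a member of \<open>P\<close>; since \<open>c\<close> has
  no loop, it can be added. Removing \<open>c\<close> keeps \<open>P\<close> inside because
  \<open>c\<close> lies outside \<open>P\<close>. As \<open>P\<close> is nonempty, the empty simplex
  remains in the target.\<close>

lemma indep_collapses:
  assumes "finite V" "P \<noteq> {}" "c \<in> V - P" "Upair c c \<notin> E"
    and nbr: "\<And>w. w \<in> V \<Longrightarrow> Upair c w \<in> E \<Longrightarrow> \<exists>p\<in>P. Upair p w \<in> E"
  shows "elementary_collapse\<^sup>*\<^sup>* (indep V E) {S \<in> indep V E. \<not> P \<subseteq> S}"
    (is "elementary_collapse\<^sup>*\<^sup>* ?K ?L")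
proof (rule toggle_collapses[where c = c])
  show K: "finite_simplicial_complex ?K"
    using assms(1) by (rule finite_simplicial_complex_indep)
  show "finite_simplicial_complex ?L"
    using K assms(2) unfolding finite_simplicial_complex_def by auto
  fix S assume S: "S \<in> ?K - ?L"
  have S': "S \<subseteq> V" "P \<subseteq> S" "\<And>v w. v \<in> S \<Longrightarrow> w \<in> S \<Longrightarrow> Upair v w \<notin> E"
    using S unfolding indep_def by blast+
  have notE: "Upair c w \<notin> E" if "w \<in> S" for w
    using S' that nbr by blast
  then have notE': "Upair w c \<notin> E" if "w \<in> S" for w
    using that by (simp add: Upair_commute[of w c])
  show "insert c S \<in> ?K - ?L"
    using S' notE notE' assms(3,4) unfolding indep_def by blast
  show "S - {c} \<in> ?K - ?L"
    using S' assms(3) unfolding indep_def by blast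
qed auto

lemma indep_collapses_insert_edge:
  assumes "finite V" "c \<in> V - {p, q}" "Upair c c \<notin> E"
    and "\<And>w. w \<in> V \<Longrightarrow> Upair c w \<in> E \<Longrightarrow> Upair p w \<in> E \<or> Upair q w \<in> E"
  shows "elementary_collapse\<^sup>*\<^sup>* (indep V E) (indep V (insert (Upair p q) E))"
  unfolding indep_insert_edge by (rule indep_collapses[where c = c]) (use assms in blast)+

text \<open>The fold lemma for independence complexes, in collapsing form: the case
  \<open>P = {p}\<close>, where the neighbourhood of \<open>c\<close> lies in that of
  \<open>p\<close>.\<close>

lemma indep_collapses_delete_vertex:
  assumes "finite V" "c \<in> V - {p}" "Upair c c \<notin> E"
    and "\<And>w. w \<in> V \<Longrightarrow> Upair c w \<in> E \<Longrightarrow> Upair p w \<in> E"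
  shows "elementary_collapse\<^sup>*\<^sup>* (indep V E) (indep (V - {p}) E)"
  unfolding indep_delete_vertex by (rule indep_collapses[where c = c]) (use assms in blast)+

text \<open>A disjoint union of graphs has the join as its independence complex, and a single edge
  \<open>y z\<close> gives two points. The condition on \<open>E'\<close> concerns only vertices of
  the smaller graph, so \<open>E'\<close> may retain edges at deleted vertices.\<close>

lemma suspension_indep:
  assumes "y \<notin> V" "z \<notin> V" "y \<noteq> z"
    and E: "\<And>v w. v \<in> V \<union> {y, z} \<Longrightarrow> w \<in> V \<union> {y, z} \<Longrightarrow>
              Upair v w \<in> E' \<longleftrightarrow> v \<in> V \<and> w \<in> V \<and> Upair v w \<in> E \<or> {v, w} = {y, z}"
  shows "suspension (indep V E) =
    image (\<lambda>v. if v = y then Inr False else if v = z then Inr True else Inl v) `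
      indep (V \<union> {y, z}) E'"
    (is "?S = image ?f ` ?I")
proof
  have fV: "?f ` \<sigma> = Inl ` \<sigma>" if "\<sigma> \<subseteq> V" for \<sigma>
    using that assms by (intro image_cong) auto
  show "?S \<subseteq> image ?f ` ?I"
  proof
    fix s assume "s \<in> ?S"
    then obtain \<sigma> \<tau> where s: "s = \<sigma> <+> \<tau>" and \<sigma>: "\<sigma> \<in> indep V E" and \<tau>: "\<tau> \<subset> {False, True}"
      unfolding suspension_def simplicial_join_def boundary_simplex1_def by blast
    have sV: "\<sigma> \<subseteq> V"
      using \<sigma> unfolding indep_def by blast
    \<comment> \<open>\<open>T\<close> is \<tau> read back in the graph, with \<open>False\<close>
      standing for \<open>y\<close> and \<open>True\<close> for \<open>z\<close>. As \<tau> is a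
      proper subset, \<open>T\<close> never contains both ends of the edge.\<close>
    define T where "T = (if False \<in> \<tau> then {y} else {}) \<union> (if True \<in> \<tau> then {z} else {})"
    have "?f ` T = Inr ` \<tau>"
      unfolding T_def using assms(3) by (auto split: if_splits) (metis (full_types) imageI)+
    then have "s = ?f ` (\<sigma> \<union> T)"
      unfolding s Plus_def image_Un fV[OF sV] by simp
    moreover have T: "T = {} \<or> T = {y} \<or> T = {z}"
      using \<tau> unfolding T_def by auto
    have "Upair v w \<notin> E'" if "v \<in> \<sigma> \<union> T" "w \<in> \<sigma> \<union> T" for v w
    proof -
      have "v \<in> V \<union> {y, z}" "w \<in> V \<union> {y, z}"
        using that sV T by auto
      moreover have "{v, w} \<noteq> {y, z}"
        using that sV T assms(1-3) by (auto simp: doubleton_eq_iff)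
      moreover have "Upair v w \<notin> E" if "v \<in> V" "w \<in> V"
        using that \<open>v \<in> \<sigma> \<union> T\<close> \<open>w \<in> \<sigma> \<union> T\<close> T assms(1,2) \<sigma> unfolding indep_def by auto
      ultimately show ?thesis
        using E by blast
    qed
    then have "\<sigma> \<union> T \<in> ?I"
      using sV T unfolding indep_def by auto
    ultimately show "s \<in> image ?f ` ?I"
      by blast
  qed
  show "image ?f ` ?I \<subseteq> ?S"
  proof
    fix s assume "s \<in> image ?f ` ?I"
    then obtain S where S: "S \<in> ?I" and s: "s = ?f ` S"
      by blast
    define \<tau> where "\<tau> = (if y \<in> S then {False} else {}) \<union> (if z \<in> S then {True} else {})"
    have SV: "S \<subseteq> V \<union> {y, z}" and ind: "\<And>v w. v \<in> S \<Longrightarrow> w \<in> S \<Longrightarrow> Upair v w \<notin> E'"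
      using S unfolding indep_def by auto
    have "?f ` (S \<inter> {y, z}) = Inr ` \<tau>"
      unfolding \<tau>_def using assms(3) by auto
    moreover have "S = S \<inter> V \<union> S \<inter> {y, z}"
      using SV by blast
    ultimately have "s = (S \<inter> V) <+> \<tau>"
      unfolding s Plus_def using fV[of "S \<inter> V"] image_Un[of ?f "S \<inter> V" "S \<inter> {y, z}"] by simp
    moreover have "S \<inter> V \<in> indep V E"
      using ind E unfolding indep_def by blast
    moreover have "\<not> (y \<in> S \<and> z \<in> S)"
      using ind[of y z] E[of y z] by auto
    then have "\<tau> \<subset> {False, True}"
      unfolding \<tau>_def by auto
    ultimately show "s \<in> ?S"
      unfolding suspension_def simplicial_join_def boundary_simplex1_def by blast
  qed
qed

theorem theorem1p2:
  fixes G H :: "'a multigraph"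
    and u\<^sub>1 u\<^sub>2 v\<^sub>1 v\<^sub>2 x\<^sub>1 x\<^sub>2 y\<^sub>1 y\<^sub>2 :: 'a
  assumes "finite_graph G"
    and "{u\<^sub>1, u\<^sub>2, v\<^sub>1, v\<^sub>2} \<subseteq> verts G"
    and "distinct [u\<^sub>1, u\<^sub>2, v\<^sub>1, v\<^sub>2]"
    and "edges (full_subgraph G {u\<^sub>1, u\<^sub>2, v\<^sub>1, v\<^sub>2}) =
           {#Upair u\<^sub>1 u\<^sub>2, Upair v\<^sub>1 v\<^sub>2, Upair u\<^sub>1 v\<^sub>1, Upair u\<^sub>2 v\<^sub>2#}"
    and "{x\<^sub>1, x\<^sub>2, y\<^sub>1, y\<^sub>2} \<inter> verts G = {}"
    and "distinct [x\<^sub>1, x\<^sub>2, y\<^sub>1, y\<^sub>2]"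
    and "H = replace_square G u\<^sub>1 u\<^sub>2 v\<^sub>1 v\<^sub>2 x\<^sub>1 x\<^sub>2 y\<^sub>1 y\<^sub>2"
  shows "same_simple_homotopy_type (independence_complex H) (suspension (independence_complex G))"
proof -
  define V where "V = verts G \<union> {x\<^sub>1, x\<^sub>2, y\<^sub>1, y\<^sub>2}"
  define E where "E = set_mset (edges G)"
  \<comment> \<open>\<open>M\<close> holds the new edges present at every stage. The edges
    \<open>y\<^sub>1 v\<^sub>2\<close> and \<open>y\<^sub>2 v\<^sub>1\<close> are left out because
    they are added separately; \<open>E0\<close> is the edge set of \<open>H\<close>.\<close>
  define M where "M = {Upair u\<^sub>1 x\<^sub>1, Upair x\<^sub>1 y\<^sub>1, Upair u\<^sub>2 x\<^sub>2, Upair x\<^sub>2 y\<^sub>2,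
                       Upair x\<^sub>1 x\<^sub>2, Upair y\<^sub>1 y\<^sub>2}"
  define E0 where "E0 = E - {Upair u\<^sub>1 v\<^sub>1, Upair u\<^sub>2 v\<^sub>2} \<union> M \<union> {Upair y\<^sub>1 v\<^sub>2, Upair y\<^sub>2 v\<^sub>1}"
  have "distinct [u\<^sub>1, u\<^sub>2, v\<^sub>1, v\<^sub>2, x\<^sub>1, x\<^sub>2, y\<^sub>1, y\<^sub>2]"
    using assms(2,3,5,6) by auto
  \<comment> \<open>The reversed list supplies every inequality in the opposite orientation.\<close>
  note dist = this[simplified] this[THEN distinct_rev[THEN iffD2], simplified]
  have finV: "finite V"
    using assms(1) unfolding V_def finite_graph_def by simp
  have in_verts: "a \<in> verts G" "b \<in> verts G" if "Upair a b \<in> E" for a b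
    using assms(1) that unfolding finite_graph_def E_def by fastforce+
  have notE: "Upair a b \<notin> E" "Upair b a \<notin> E" if "a \<in> {x\<^sub>1, x\<^sub>2, y\<^sub>1, y\<^sub>2}" for a b
    using in_verts assms(5) that by blast+
  have count: "count (edges G) e =
      count {#Upair u\<^sub>1 u\<^sub>2, Upair v\<^sub>1 v\<^sub>2, Upair u\<^sub>1 v\<^sub>1, Upair u\<^sub>2 v\<^sub>2#} e"
    if "set_uprod e \<subseteq> {u\<^sub>1, u\<^sub>2, v\<^sub>1, v\<^sub>2}" for e
    using arg_cong[OF assms(4), of "\<lambda>N. count N e"] that unfolding full_subgraph_def by simp
  \<comment> \<open>Multiset difference deletes one copy of each edge, so multiplicity exactly one
    is what makes these edges vanish from the edge set.\<close>
  have c1: "count (edges G) (Upair u\<^sub>1 v\<^sub>1) = 1" and c2: "count (edges G) (Upair u\<^sub>2 v\<^sub>2) = 1"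
    and "count (edges G) (Upair u\<^sub>1 u\<^sub>2) = 1"
    using count dist by auto
  then have square: "Upair u\<^sub>1 u\<^sub>2 \<in> E" "Upair u\<^sub>1 v\<^sub>1 \<in> E" "Upair u\<^sub>2 v\<^sub>2 \<in> E"
    unfolding E_def by (simp_all flip: count_greater_zero_iff)
  have "e \<in># edges G - {#Upair u\<^sub>1 v\<^sub>1, Upair u\<^sub>2 v\<^sub>2#} \<longleftrightarrow>
      e \<in> E - {Upair u\<^sub>1 v\<^sub>1, Upair u\<^sub>2 v\<^sub>2}" for e
  proof (cases "e \<in> {Upair u\<^sub>1 v\<^sub>1, Upair u\<^sub>2 v\<^sub>2}")
    case True
    then show ?thesis
      using c1 c2 unfolding in_diff_count by (elim insertE) simp_all
  next
    case False
    then have "count {#Upair u\<^sub>1 v\<^sub>1, Upair u\<^sub>2 v\<^sub>2#} e = 0"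
      by auto
    with False show ?thesis
      unfolding in_diff_count E_def by simp
  qed
  then have "set_mset (edges G - {#Upair u\<^sub>1 v\<^sub>1, Upair u\<^sub>2 v\<^sub>2#}) =
      E - {Upair u\<^sub>1 v\<^sub>1, Upair u\<^sub>2 v\<^sub>2}"
    by (rule set_eqI)
  then have H: "independence_complex H = indep V E0"
    unfolding independence_complex_eq_indep assms(7) replace_square_def V_def E0_def M_def
    by (simp add: insert_commute Un_commute)

  \<comment> \<open>Neighbourhoods of the new vertices\<close>
  let ?D = "insert (Upair y\<^sub>1 v\<^sub>2) (insert (Upair y\<^sub>2 v\<^sub>1) (E \<union> M))"
  \<comment> \<open>\<open>?D\<close> contains the edge set of every stage, so the bounds for
    \<open>x\<^sub>1\<close> and \<open>x\<^sub>2\<close> apply throughout. Those for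
    \<open>y\<^sub>1\<close> and \<open>y\<^sub>2\<close> hold only in \<open>E \<union> M\<close>,
    where the edges to \<open>v\<^sub>2\<close> and \<open>v\<^sub>1\<close> are absent.\<close>
  have nbr_x1: "w \<in> {u\<^sub>1, y\<^sub>1, x\<^sub>2}" if "Upair x\<^sub>1 w \<in> ?D" for w
    using that notE(1)[of x\<^sub>1 w] dist unfolding M_def by auto
  have nbr_x2: "w \<in> {u\<^sub>2, y\<^sub>2, x\<^sub>1}" if "Upair x\<^sub>2 w \<in> ?D" for w
    using that notE(1)[of x\<^sub>2 w] dist unfolding M_def by auto
  have nbr_y1: "w \<in> {x\<^sub>1, y\<^sub>2}" if "Upair y\<^sub>1 w \<in> E \<union> M" for w
    using that notE(1)[of y\<^sub>1 w] dist unfolding M_def by auto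
  have nbr_y2: "w \<in> {x\<^sub>2, y\<^sub>1}" if "Upair y\<^sub>2 w \<in> E \<union> M" for w
    using that notE(1)[of y\<^sub>2 w] dist unfolding M_def by auto
  have edge_M: "Upair u\<^sub>1 x\<^sub>1 \<in> M" "Upair y\<^sub>1 x\<^sub>1 \<in> M" "Upair x\<^sub>1 y\<^sub>1 \<in> M"
    "Upair u\<^sub>2 x\<^sub>2 \<in> M" "Upair y\<^sub>2 x\<^sub>2 \<in> M" "Upair x\<^sub>2 y\<^sub>2 \<in> M"
    "Upair x\<^sub>1 x\<^sub>2 \<in> M" "Upair x\<^sub>2 x\<^sub>1 \<in> M" "Upair y\<^sub>1 y\<^sub>2 \<in> M" "Upair y\<^sub>2 y\<^sub>1 \<in> M"
    unfolding M_def by simp_all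
  have edge_E: "Upair v\<^sub>1 u\<^sub>1 \<in> E" "Upair v\<^sub>2 u\<^sub>2 \<in> E" "Upair u\<^sub>2 u\<^sub>1 \<in> E"
    using square by (simp_all add: Upair_commute)
  have sub: "E0 \<subseteq> ?D" "insert (Upair u\<^sub>1 v\<^sub>1) E0 \<subseteq> ?D"
    "E \<union> M \<subseteq> ?D" "insert (Upair y\<^sub>2 v\<^sub>1) (E \<union> M) \<subseteq> ?D"
    using square unfolding E0_def by auto
  have M_sub: "M \<subseteq> E0"
    unfolding E0_def by auto
  have edge_E0: "Upair u\<^sub>1 u\<^sub>2 \<in> E0" "Upair u\<^sub>2 u\<^sub>1 \<in> E0" "Upair v\<^sub>1 y\<^sub>2 \<in> E0" "Upair v\<^sub>2 y\<^sub>1 \<in> E0"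
    using square edge_E dist unfolding E0_def by simp_all

  \<comment> \<open>Collapse from \<open>H\<close> to the common complex\<close>
  have "elementary_collapse\<^sup>*\<^sup>* (indep V E0) (indep V (insert (Upair u\<^sub>1 v\<^sub>1) E0))"
  proof (rule indep_collapses_insert_edge[where c = x\<^sub>2])
    \<comment> \<open>Among the neighbours of \<open>x\<^sub>2\<close>, \<open>u\<^sub>2\<close> and
      \<open>x\<^sub>1\<close> are adjacent to \<open>u\<^sub>1\<close>, and
      \<open>y\<^sub>2\<close> to \<open>v\<^sub>1\<close>.\<close>
    show "Upair u\<^sub>1 w \<in> E0 \<or> Upair v\<^sub>1 w \<in> E0" if "Upair x\<^sub>2 w \<in> E0" for w
      using nbr_x2[OF subsetD[OF sub(1) that]] edge_E0 edge_M[THEN subsetD[OF M_sub]] by auto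
    show "Upair x\<^sub>2 x\<^sub>2 \<notin> E0"
      using nbr_x2[OF subsetD[OF sub(1)], of x\<^sub>2] dist by auto
  qed (use finV dist in \<open>simp_all add: V_def\<close>)
  moreover have "elementary_collapse\<^sup>*\<^sup>* (indep V (insert (Upair u\<^sub>1 v\<^sub>1) E0))
      (indep V (insert (Upair u\<^sub>2 v\<^sub>2) (insert (Upair u\<^sub>1 v\<^sub>1) E0)))"
    (is "elementary_collapse\<^sup>*\<^sup>* (indep V ?E) _")
  proof (rule indep_collapses_insert_edge[where c = x\<^sub>1])
    \<comment> \<open>The mirror image: \<open>u\<^sub>1\<close> and \<open>x\<^sub>2\<close> are
      adjacent to \<open>u\<^sub>2\<close>, and \<open>y\<^sub>1\<close> to
      \<open>v\<^sub>2\<close>.\<close>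
    show "Upair u\<^sub>2 w \<in> ?E \<or> Upair v\<^sub>2 w \<in> ?E" if "Upair x\<^sub>1 w \<in> ?E" for w
      using nbr_x1[OF subsetD[OF sub(2) that]] edge_E0 edge_M[THEN subsetD[OF M_sub]] by auto
    show "Upair x\<^sub>1 x\<^sub>1 \<notin> ?E"
      using nbr_x1[OF subsetD[OF sub(2)], of x\<^sub>1] dist by auto
  qed (use finV dist in \<open>simp_all add: V_def\<close>)
  moreover have "insert (Upair u\<^sub>2 v\<^sub>2) (insert (Upair u\<^sub>1 v\<^sub>1) E0) = ?D"
    using square unfolding E0_def by auto
  ultimately have to_L: "elementary_collapse\<^sup>*\<^sup>* (indep V E0) (indep V ?D)"
    by simp

  \<comment> \<open>Collapse from the intermediate graph to the common complex\<close>
  have "elementary_collapse\<^sup>*\<^sup>* (indep V (E \<union> M)) (indep V (insert (Upair y\<^sub>2 v\<^sub>1) (E \<union> M)))"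
  proof (rule indep_collapses_insert_edge[where c = x\<^sub>1])
    \<comment> \<open>Now \<open>y\<^sub>1\<close> and \<open>x\<^sub>2\<close> are adjacent to
      \<open>y\<^sub>2\<close>, while \<open>u\<^sub>1\<close> is adjacent to
      \<open>v\<^sub>1\<close> by the restored edge of the square; the next step is again its mirror
      image.\<close>
    show "Upair y\<^sub>2 w \<in> E \<union> M \<or> Upair v\<^sub>1 w \<in> E \<union> M" if "Upair x\<^sub>1 w \<in> E \<union> M" for w
      using nbr_x1[OF subsetD[OF sub(3) that]] edge_E edge_M by auto
    show "Upair x\<^sub>1 x\<^sub>1 \<notin> E \<union> M"
      using nbr_x1[OF subsetD[OF sub(3)], of x\<^sub>1] dist by auto
  qed (use finV dist in \<open>simp_all add: V_def\<close>)
  moreover have "elementary_collapse\<^sup>*\<^sup>* (indep V (insert (Upair y\<^sub>2 v\<^sub>1) (E \<union> M))) (indep V ?D)"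
    (is "elementary_collapse\<^sup>*\<^sup>* (indep V ?E) _")
  proof (rule indep_collapses_insert_edge[where c = x\<^sub>2])
    show "Upair y\<^sub>1 w \<in> ?E \<or> Upair v\<^sub>2 w \<in> ?E" if "Upair x\<^sub>2 w \<in> ?E" for w
      using nbr_x2[OF subsetD[OF sub(4) that]] edge_E edge_M by auto
    show "Upair x\<^sub>2 x\<^sub>2 \<notin> ?E"
      using nbr_x2[OF subsetD[OF sub(4)], of x\<^sub>2] dist by auto
  qed (use finV dist in \<open>simp_all add: V_def\<close>)
  ultimately have expand_L: "elementary_collapse\<^sup>*\<^sup>* (indep V (E \<union> M)) (indep V ?D)"
    by simp

  \<comment> \<open>Folding away \<open>x\<^sub>1\<close> and \<open>x\<^sub>2\<close>\<close>
  have "elementary_collapse\<^sup>*\<^sup>* (indep V (E \<union> M)) (indep (V - {x\<^sub>1}) (E \<union> M))"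
  proof (rule indep_collapses_delete_vertex[where c = y\<^sub>2])
    \<comment> \<open>Both possible neighbours of \<open>y\<^sub>2\<close>, namely
      \<open>x\<^sub>2\<close> and \<open>y\<^sub>1\<close>, are adjacent to
      \<open>x\<^sub>1\<close>; symmetrically \<open>y\<^sub>1\<close> allows
      \<open>x\<^sub>2\<close> to be deleted.\<close>
    show "Upair x\<^sub>1 w \<in> E \<union> M" if "Upair y\<^sub>2 w \<in> E \<union> M" for w
      using nbr_y2[OF that] edge_M by auto
    show "Upair y\<^sub>2 y\<^sub>2 \<notin> E \<union> M"
      using nbr_y2[of y\<^sub>2] dist by auto
  qed (use finV dist in \<open>simp_all add: V_def\<close>)
  moreover have "elementary_collapse\<^sup>*\<^sup>* (indep (V - {x\<^sub>1}) (E \<union> M))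
      (indep (V - {x\<^sub>1} - {x\<^sub>2}) (E \<union> M))"
  proof (rule indep_collapses_delete_vertex[where c = y\<^sub>1])
    show "Upair x\<^sub>2 w \<in> E \<union> M" if "Upair y\<^sub>1 w \<in> E \<union> M" for w
      using nbr_y1[OF that] edge_M by auto
    show "Upair y\<^sub>1 y\<^sub>1 \<notin> E \<union> M"
      using nbr_y1[of y\<^sub>1] dist by auto
  qed (use finV dist in \<open>simp_all add: V_def\<close>)
  moreover have V: "V - {x\<^sub>1} - {x\<^sub>2} = verts G \<union> {y\<^sub>1, y\<^sub>2}"
    using assms(5) dist unfolding V_def by auto
  ultimately have to_N: "elementary_collapse\<^sup>*\<^sup>* (indep V (E \<union> M))
      (indep (verts G \<union> {y\<^sub>1, y\<^sub>2}) (E \<union> M))"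
    by simp

  \<comment> \<open>Identification with the suspension\<close>
  let ?f = "\<lambda>v. if v = y\<^sub>1 then Inr False else if v = y\<^sub>2 then Inr True else Inl v"
  have "suspension (independence_complex G) =
      image ?f ` indep (verts G \<union> {y\<^sub>1, y\<^sub>2}) (E \<union> M)"
    unfolding independence_complex_eq_indep E_def[symmetric]
  proof (rule suspension_indep)
    fix v w assume vw: "v \<in> verts G \<union> {y\<^sub>1, y\<^sub>2}" "w \<in> verts G \<union> {y\<^sub>1, y\<^sub>2}"
    \<comment> \<open>Every edge of \<open>M\<close> other than \<open>y\<^sub>1 y\<^sub>2\<close>
      meets \<open>x\<^sub>1\<close> or \<open>x\<^sub>2\<close>, which are gone.\<close>
    have "Upair v w \<in> M \<longleftrightarrow> {v, w} = {y\<^sub>1, y\<^sub>2}"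
      using vw assms(5) dist unfolding M_def by (auto simp: doubleton_eq_iff)
    then show "Upair v w \<in> E \<union> M \<longleftrightarrow>
        v \<in> verts G \<and> w \<in> verts G \<and> Upair v w \<in> E \<or> {v, w} = {y\<^sub>1, y\<^sub>2}"
      using in_verts by auto
  qed (use assms(5) dist in auto)
  moreover have "inj_on ?f A" for A
    by (auto simp: inj_on_def)
  ultimately show ?thesis
    using same_simple_homotopy_type_zigzag[OF _ _ to_L expand_L to_N, of ?f]
      finite_simplicial_complex_indep[OF finV] H by simp
qed

end
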